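(* Let $a,b,c\in\mathbb{R}$ with $a\neq0$, let $g:\mathbb{R}\to\mathbb{R}$, $g(x)=ax^2+bx+c$, let $\delta:=b^2-4ac-2b-7$, and assume $\delta\ge0$. Then: (i) If $\delta=0$, the 3-cycle $\mathcal{C}_{\langle0\rangle}$ of the map $x_{t+1}=g(x_t)$ is nonhyperbolic. (ii) If $\delta>0$, the 3-cycle $\mathcal{C}_{\langle-\delta\rangle}$ is hyperbolic, while $\mathcal{C}_{\langle\delta\rangle}$ is nonhyperbolic if and only if $$\delta=\delta_{nh}:=\frac{\left(\left(460+60\sqrt{201}\right)^{\frac{2}{3}}-2\left(460+60\sqrt{201}\right)^{\frac{1}{3}}-80\right)^{2}}{36\left(460+60\sqrt{201}\right)^{\frac{2}{3}}}\approx0.074.$$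
   Context: A 3-cycle of the map $x_{t+1}=g(x_t)$ is the class, modulo cyclic permutation, of an ordered triple $(x,y,z)$ of pairwise distinct real numbers with $g(x)=y$, $g(y)=z$, $g(z)=x$; its points are $x,y,z$. A 3-cycle with points $x,y,z$ is hyperbolic if $|g'(x)g'(y)g'(z)|\neq1$, and nonhyperbolic otherwise. For $\beta\in\mathbb{R}$ let $Q_\beta(X)=X^3+(1-\beta)X^2-(2+\beta)X-1$. All roots of $Q_\beta$ are real, distinct and nonzero; they are denoted $q^{\langle\beta\rangle}_1<q^{\langle\beta\rangle}_2<q^{\langle\beta\rangle}_3$. For $\delta=0$ the map has a unique 3-cycle $\mathcal{C}_{\langle0\rangle}$, whose points are $\frac{-b+1}{2a}+\frac{1}{a q^{\langle0\rangle}_i}$, $i\in\{1,2,3\}$. For $\delta>0$ the map has exactly two 3-cycles: $\mathcal{C}_{\langle\delta\rangle}$, whose points are $\frac{-b+\sqrt{\delta}+1}{2a}+\frac{1}{a q^{\langle\sqrt{\delta}\rangle}_i}$, and $\mathcal{C}_{\langle-\delta\rangle}$, whose points are $\frac{-b-\sqrt{\delta}+1}{2a}+\frac{1}{a q^{\langle-\sqrt{\delta}\rangle}_i}$, $i\in\{1,2,3\}$. *)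

theory Defs
  imports "HOL-Analysis.Analysis" "HOL-Computational_Algebra.Polynomial"
begin

text \<open>A 3-cycle is the class of an ordered triple modulo cyclic permutation, represented
  as the set of its three rotations.\<close>

definition three_cycle :: "(real \<Rightarrow> real) \<Rightarrow> (real \<times> real \<times> real) set \<Rightarrow> bool" where
  "three_cycle g C \<longleftrightarrow>
     (\<exists>x y z. distinct [x, y, z] \<and> g x = y \<and> g y = z \<and> g z = x \<and>
              C = {(x, y, z), (y, z, x), (z, x, y)})"

definition points :: "(real \<times> real \<times> real) set \<Rightarrow> real set" where
  "points C = (\<Union>(x, y, z)\<in>C. {x, y, z})"

text \<open>Only meaningful for a 3-cycle of \<open>g\<close>; its points are distinct, so the product over
  the set of points has exactly three factors.\<close>

definition hyperbolic :: "(real \<Rightarrow> real) \<Rightarrow> (real \<times> real \<times> real) set \<Rightarrow> bool" where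
  "hyperbolic g C \<longleftrightarrow> \<bar>\<Prod>p\<in>points C. deriv g p\<bar> \<noteq> 1"

abbreviation nonhyperbolic :: "(real \<Rightarrow> real) \<Rightarrow> (real \<times> real \<times> real) set \<Rightarrow> bool" where
  "nonhyperbolic g C \<equiv> \<not> hyperbolic g C"

definition Q :: "real \<Rightarrow> real poly" where
  "Q \<beta> = [:-1, -(2 + \<beta>), 1 - \<beta>, 1:]"

text \<open>\<open>q \<beta> i\<close> is the \<open>i\<close>-th smallest root of \<open>Q \<beta>\<close>, for \<open>i = 1, 2, 3\<close>.\<close>

definition q :: "real \<Rightarrow> nat \<Rightarrow> real" where
  "q \<beta> i = sorted_list_of_set {x. poly (Q \<beta>) x = 0} ! (i - 1)"

definition cycle_points :: "real \<Rightarrow> real \<Rightarrow> real \<Rightarrow> real set" where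
  "cycle_points a b \<beta> = (\<lambda>i. (- b + \<beta> + 1) / (2 * a) + 1 / (a * q \<beta> i)) ` {1, 2, 3}"

text \<open>The 3-cycle of \<open>g\<close> with the points above. The parameter \<open>\<beta>\<close> is the signed square root:
  \<open>\<beta> = 0\<close>, \<open>\<beta> = sqrt \<delta>\<close> and \<open>\<beta> = - sqrt \<delta>\<close> give the cycles with subscripts
  \<open>0\<close>, \<open>\<delta>\<close> and \<open>-\<delta>\<close> respectively.\<close>

definition cycle :: "(real \<Rightarrow> real) \<Rightarrow> real \<Rightarrow> real \<Rightarrow> real \<Rightarrow> (real \<times> real \<times> real) set" where
  "cycle g a b \<beta> = (THE C. three_cycle g C \<and> points C = cycle_points a b \<beta>)"

definition delta_nh :: real where
  "delta_nh =
     ((460 + 60 * sqrt 201) powr (2/3) - 2 * (460 + 60 * sqrt 201) powr (1/3) - 80)\<^sup>2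
       / (36 * (460 + 60 * sqrt 201) powr (2/3))"

end

theory Submission
  imports Defs
begin

text \<open>The order-3 Moebius map \<open>r \<mapsto> -1 / (1 + r)\<close> permutes the roots of \<open>Q \<beta>\<close>, so one root \<open>r\<close>
  gives all three. In the coordinate \<open>s = 1 / r\<close>, the map \<open>g\<close> becomes
  \<open>s \<mapsto> s\<^sup>2 + (\<beta> + 1) s - 2\<close>, which permutes the reciprocals cyclically, and \<open>g'\<close> becomes
  \<open>\<beta> + 1 + 2 s\<close>. By Vieta the multiplier of the cycle is \<open>1 - 7 \<beta> - \<beta>\<^sup>2 - \<beta>\<^sup>3\<close>. It equals \<open>1\<close> only
  for \<open>\<beta> = 0\<close>, and it equals \<open>-1\<close> only at the real root of \<open>\<beta>\<^sup>3 + \<beta>\<^sup>2 + 7 \<beta> - 2\<close>, which Cardano's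
  formula expresses as the square root of \<open>delta_nh\<close>.\<close>

lemma three_cycle_eq_image_points:
  assumes "three_cycle g C"
  shows "C = (\<lambda>x. (x, g x, g (g x))) ` points C"
  using assms unfolding three_cycle_def points_def by auto

lemma cycle_eqI:
  assumes "three_cycle g C" "points C = cycle_points a b \<beta>"
  shows "cycle g a b \<beta> = C"
  unfolding cycle_def using assms three_cycle_eq_image_points by (intro the_equality) metis+

lemma poly_Q: "poly (Q \<beta>) x = x ^ 3 + (1 - \<beta>) * x\<^sup>2 - (2 + \<beta>) * x - 1"
  unfolding Q_def by (simp add: algebra_simps power2_eq_square power3_eq_cube)

lemma Q_has_root: "\<exists>r. poly (Q \<beta>) r = 0 \<and> r \<noteq> 0 \<and> r \<noteq> -1"
proof -
  have "poly (Q \<beta>) (-1) = 1" "poly (Q \<beta>) 0 = -1" by (simp_all add: poly_Q)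
  then show ?thesis using poly_IVT_neg[of "-1" 0 "Q \<beta>"] by force
qed

lemma Moebius_images_distinct:
  fixes r :: real
  assumes "r \<noteq> 0" "r \<noteq> -1"
  shows "distinct [r, - 1 / (1 + r), - (1 + r) / r]"
proof -
  have "r\<^sup>2 + r + 1 = (r + 1 / 2)\<^sup>2 + 3 / 4" by (simp add: power2_eq_square algebra_simps)
  then have "r\<^sup>2 + r + 1 > 0"
    by (metis add_nonneg_pos zero_le_power2 zero_less_divide_iff zero_less_numeral)
  moreover have "1 + r \<noteq> 0" using assms by linarith
  ultimately show ?thesis using assms
    by (auto simp: field_simps power2_eq_square)
qed

lemma Q_roots:
  assumes "poly (Q \<beta>) r = 0" "r \<noteq> 0" "r \<noteq> -1"
  shows "{x. poly (Q \<beta>) x = 0} = {r, - 1 / (1 + r), - (1 + r) / r}"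
proof -
  have r1: "1 + r \<noteq> 0" using assms(3) by linarith
  have "r * (1 + r) * poly (Q \<beta>) x = (x - r) * ((1 + r) * x + 1) * (r * x + (1 + r))" for x
    using assms(1) unfolding poly_Q by algebra
  then have "poly (Q \<beta>) x = 0 \<longleftrightarrow> x = r \<or> (1 + r) * x + 1 = 0 \<or> r * x + (1 + r) = 0" for x
    using assms(2) r1 by (metis eq_iff_diff_eq_0 mult_eq_0_iff)
  moreover have "(1 + r) * x + 1 = 0 \<longleftrightarrow> x = - 1 / (1 + r)" for x
    using r1 by (auto simp: field_simps)
  moreover have "r * x + (1 + r) = 0 \<longleftrightarrow> x = - (1 + r) / r" for x
    using assms(2) by (auto simp: field_simps)
  ultimately show ?thesis by auto
qed

lemma q_image:
  assumes "card {x. poly (Q \<beta>) x = 0} = 3"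
  shows "q \<beta> ` {1, 2, 3} = {x. poly (Q \<beta>) x = 0}"
proof -
  let ?R = "{x. poly (Q \<beta>) x = 0}"
  have "finite ?R" using assms card.infinite by fastforce
  then have "set (sorted_list_of_set ?R) = ?R" "length (sorted_list_of_set ?R) = 3"
    using assms by auto
  moreover have "{0..<3::nat} = {0, 1, 2}" by auto
  ultimately have "?R = (!) (sorted_list_of_set ?R) ` {0, 1, 2}"
    using nth_image[of 3 "sorted_list_of_set ?R"] by simp
  then show ?thesis unfolding q_def by (auto simp: image_iff)
qed

lemma cycle_points_eq:
  assumes "poly (Q \<beta>) r = 0" "r \<noteq> 0" "r \<noteq> -1"
  shows "cycle_points a b \<beta> =
    (\<lambda>s. (- b + \<beta> + 1) / (2 * a) + s / a) ` {1 / r, - r / (1 + r), - (1 + r)}"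
proof -
  let ?R = "{x. poly (Q \<beta>) x = 0}"
  have "card ?R = 3"
    using distinct_card[OF Moebius_images_distinct[OF assms(2,3)]] Q_roots[OF assms] by simp
  then have "cycle_points a b \<beta> = (\<lambda>x. (- b + \<beta> + 1) / (2 * a) + 1 / (a * x)) ` ?R"
    unfolding cycle_points_def q_image[OF \<open>card ?R = 3\<close>, symmetric] by (simp only: image_image)
  also have "\<dots> = (\<lambda>x. (- b + \<beta> + 1) / (2 * a) + (1 / x) / a) ` ?R"
    by (simp add: mult.commute)
  finally show ?thesis unfolding Q_roots[OF assms] using assms(2,3)
    by (simp add: insert_commute minus_divide_left[symmetric] minus_divide_right)
qed

context
  fixes a b c \<beta> :: real and g :: "real \<Rightarrow> real"
  assumes a: "a \<noteq> 0"
    and g: "g = (\<lambda>x. a * x\<^sup>2 + b * x + c)"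
    and \<beta>: "\<beta>\<^sup>2 = b\<^sup>2 - 4 * a * c - 2 * b - 7"
begin

lemma g_conjugate:
  "g ((- b + \<beta> + 1) / (2 * a) + s / a) =
   (- b + \<beta> + 1) / (2 * a) + (s\<^sup>2 + (\<beta> + 1) * s - 2) / a"
proof -
  define x where "x = (- b + \<beta> + 1) / (2 * a) + s / a"
  have x: "2 * a * x = - b + \<beta> + 1 + 2 * s" unfolding x_def using a by (simp add: field_simps)
  have "4 * a * g x = 2 * (- b + \<beta> + 1) + 4 * (s\<^sup>2 + (\<beta> + 1) * s - 2)"
    unfolding g using x \<beta> by algebra
  then have "g x = (2 * (- b + \<beta> + 1) + 4 * (s\<^sup>2 + (\<beta> + 1) * s - 2)) / (4 * a)"
    using a by (simp add: eq_divide_eq mult.commute)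
  also have "\<dots> = (- b + \<beta> + 1) / (2 * a) + (s\<^sup>2 + (\<beta> + 1) * s - 2) / a"
    using a by (simp add: field_simps)
  finally show ?thesis unfolding x_def .
qed

lemma deriv_g: "deriv g ((- b + \<beta> + 1) / (2 * a) + s / a) = \<beta> + 1 + 2 * s"
proof -
  have "deriv g x = 2 * a * x + b" for x
    unfolding g by (rule DERIV_imp_deriv) (auto intro!: derivative_eq_intros)
  then show ?thesis using a by (simp add: field_simps)
qed

lemma cycle_properties:
  "three_cycle g (cycle g a b \<beta>)"
  "points (cycle g a b \<beta>) = cycle_points a b \<beta>"
  "(\<Prod>p\<in>cycle_points a b \<beta>. deriv g p) = 1 - 7 * \<beta> - \<beta>\<^sup>2 - \<beta> ^ 3"
proof -
  obtain r where r: "poly (Q \<beta>) r = 0" "r \<noteq> 0" "r \<noteq> -1" using Q_has_root by blast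
  define h where "h = (\<lambda>s. (- b + \<beta> + 1) / (2 * a) + s / a)"
  define s where "s = 1 / r"
  define t where "t = - r / (1 + r)"
  define u where "u = - (1 + r)"
  have r1: "1 + r \<noteq> 0" using r(3) by linarith
  have P: "cycle_points a b \<beta> = {h s, h t, h u}"
    using cycle_points_eq[OF r] unfolding h_def s_def t_def u_def by simp
  have rel: "s * r = 1" "t * (1 + r) = - r" "u = - (1 + r)"
    using r r1 by (simp_all add: s_def t_def u_def)
  have Qr: "r ^ 3 + (1 - \<beta>) * r\<^sup>2 - (2 + \<beta>) * r - 1 = 0" using r(1) unfolding poly_Q .
  have e: "s + t + u = - (2 + \<beta>)" "s * t + t * u + u * s = - (1 - \<beta>)" "s * t * u = 1"
  proof -
    have "r * (1 + r) * (s + t + u) = r * (1 + r) * (- (2 + \<beta>))"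
      using rel Qr by algebra
    then show "s + t + u = - (2 + \<beta>)" using r r1 by simp
    have "r * (1 + r) * (s * t + t * u + u * s) = r * (1 + r) * (- (1 - \<beta>))"
      using rel Qr by algebra
    then show "s * t + t * u + u * s = - (1 - \<beta>)" using r r1
      by (metis mult_cancel_left mult_eq_0_iff)
    have "r * (1 + r) * (s * t * u) = r * (1 + r) * 1"
      using rel by algebra
    then show "s * t * u = 1" using r r1 by simp
  qed
  have st: "s\<^sup>2 + (\<beta> + 1) * s - 2 = t"
  proof -
    have "r * r * (1 + r) * (s\<^sup>2 + (\<beta> + 1) * s - 2) = r * r * (1 + r) * t"
      using rel Qr by algebra
    then show ?thesis using r r1 by simp
  qed
  have tu: "t\<^sup>2 + (\<beta> + 1) * t - 2 = u"
  proof -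
    have "r * (1 + r) * (1 + r) * (t\<^sup>2 + (\<beta> + 1) * t - 2) = r * (1 + r) * (1 + r) * u"
      using rel Qr by algebra
    then show ?thesis using r r1 by simp
  qed
  have us: "u\<^sup>2 + (\<beta> + 1) * u - 2 = s"
  proof -
    have "r * (u\<^sup>2 + (\<beta> + 1) * u - 2) = r * s"
      using rel Qr by algebra
    then show ?thesis using r by simp
  qed
  have "distinct [s, t, u]"
    using Moebius_images_distinct[OF r(2,3)] r r1 unfolding s_def t_def u_def
    by (auto simp: field_simps)
  then have d: "distinct [h s, h t, h u]" unfolding h_def using a by auto
  define C where "C = {(h s, h t, h u), (h t, h u, h s), (h u, h s, h t)}"
  have "g (h s) = h t" "g (h t) = h u" "g (h u) = h s"
    using g_conjugate st tu us unfolding h_def by simp_all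
  then have C: "three_cycle g C" unfolding three_cycle_def C_def using d by blast
  have pC: "points C = cycle_points a b \<beta>" unfolding P points_def C_def by auto
  have "cycle g a b \<beta> = C" using C pC by (rule cycle_eqI)
  then show "three_cycle g (cycle g a b \<beta>)" "points (cycle g a b \<beta>) = cycle_points a b \<beta>"
    using C pC by simp_all
  have "(\<Prod>p\<in>cycle_points a b \<beta>. deriv g p) = (\<beta> + 1 + 2 * s) * (\<beta> + 1 + 2 * t) * (\<beta> + 1 + 2 * u)"
    unfolding P using d deriv_g unfolding h_def by simp
  also have "\<dots> = (\<beta> + 1) ^ 3 + 2 * (\<beta> + 1)\<^sup>2 * (s + t + u)
      + 4 * (\<beta> + 1) * (s * t + t * u + u * s) + 8 * (s * t * u)"
    by algebra
  also have "\<dots> = 1 - 7 * \<beta> - \<beta>\<^sup>2 - \<beta> ^ 3" unfolding e by algebra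
  finally show "(\<Prod>p\<in>cycle_points a b \<beta>. deriv g p) = 1 - 7 * \<beta> - \<beta>\<^sup>2 - \<beta> ^ 3" .
qed

lemma nonhyperbolic_cycle_iff:
  "nonhyperbolic g (cycle g a b \<beta>) \<longleftrightarrow> \<beta> = 0 \<or> \<beta> ^ 3 + \<beta>\<^sup>2 + 7 * \<beta> = 2"
proof -
  have "\<beta>\<^sup>2 + \<beta> + 7 = (\<beta> + 1 / 2)\<^sup>2 + 27 / 4" by (simp add: power2_eq_square algebra_simps)
  then have "\<beta>\<^sup>2 + \<beta> + 7 \<noteq> 0"
    by (metis add_nonneg_pos less_irrefl zero_le_power2 zero_less_divide_iff zero_less_numeral)
  moreover have "\<beta> ^ 3 + \<beta>\<^sup>2 + 7 * \<beta> = \<beta> * (\<beta>\<^sup>2 + \<beta> + 7)" by algebra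
  ultimately have "\<beta> ^ 3 + \<beta>\<^sup>2 + 7 * \<beta> = 0 \<longleftrightarrow> \<beta> = 0" by simp
  moreover have "nonhyperbolic g (cycle g a b \<beta>) \<longleftrightarrow> \<bar>1 - 7 * \<beta> - \<beta>\<^sup>2 - \<beta> ^ 3\<bar> = 1"
    unfolding hyperbolic_def cycle_properties by simp
  ultimately show ?thesis by linarith
qed

end

lemma cubic_strict_mono: "strict_mono (\<lambda>x::real. x ^ 3 + x\<^sup>2 + 7 * x)"
proof (rule strict_monoI)
  fix x y :: real
  assume "x < y"
  moreover have "x\<^sup>2 + x * y + y\<^sup>2 + x + y + 7 > 0"
  proof -
    have "x\<^sup>2 + x * y + y\<^sup>2 + x + y + 7 = ((x + y)\<^sup>2 + (x + 1)\<^sup>2 + (y + 1)\<^sup>2) / 2 + 6"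
      by (simp add: power2_eq_square field_simps)
    also have "\<dots> > 0" by (intro add_nonneg_pos divide_nonneg_pos add_nonneg_nonneg) simp_all
    finally show ?thesis .
  qed
  ultimately have "0 < (y - x) * (x\<^sup>2 + x * y + y\<^sup>2 + x + y + 7)" by simp
  also have "\<dots> = (y ^ 3 + y\<^sup>2 + 7 * y) - (x ^ 3 + x\<^sup>2 + 7 * x)" by algebra
  finally show "x ^ 3 + x\<^sup>2 + 7 * x < y ^ 3 + y\<^sup>2 + 7 * y" by simp
qed

text \<open>Cardano: \<open>y = 6 \<beta> + 2\<close> satisfies \<open>y\<^sup>3 + 240 y = 920\<close>, solved by \<open>y = w - v\<close> with
  \<open>w v = 80\<close> and \<open>w\<^sup>3 - v\<^sup>3 = 920\<close>.\<close>

lemma delta_nh_eq: "\<exists>\<beta>. \<beta> ^ 3 + \<beta>\<^sup>2 + 7 * \<beta> = 2 \<and> delta_nh = \<beta>\<^sup>2"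
proof -
  define k where "k = 460 + 60 * sqrt (201::real)"
  define w where "w = k powr (1/3)"
  define v where "v = 80 / w"
  define \<beta> where "\<beta> = (w - v - 2) / 6"
  have k: "k > 0" unfolding k_def by (simp add: add_pos_nonneg)
  then have w: "w > 0" unfolding w_def by simp
  have w2: "k powr (2/3) = w\<^sup>2"
    unfolding w_def power2_eq_square powr_add[symmetric] by simp
  have w3: "w ^ 3 = k" unfolding w_def using k by (simp add: powr_power)
  have "(k - 460)\<^sup>2 = 723600" unfolding k_def by (simp add: power_mult_distrib)
  then have "k * (k - 920) = 512000" by (simp add: power2_eq_square algebra_simps)
  moreover have wv: "w * v = 80" unfolding v_def using w by simp
  then have "k * v ^ 3 = 512000"
    unfolding w3[symmetric] power_mult_distrib[symmetric] by simp
  ultimately have "k * v ^ 3 = k * (k - 920)" by simp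
  then have "v ^ 3 = k - 920" using k by simp
  moreover have b: "w - v = 6 * \<beta> + 2" unfolding \<beta>_def by argo
  ultimately have "216 * (\<beta> ^ 3 + \<beta>\<^sup>2 + 7 * \<beta>) = 216 * 2" using wv w3 by algebra
  then have "\<beta> ^ 3 + \<beta>\<^sup>2 + 7 * \<beta> = 2" by simp
  moreover have "delta_nh = \<beta>\<^sup>2"
  proof -
    have "w\<^sup>2 - 2 * w - 80 = w * (w - v - 2)"
      using wv by (simp add: power2_eq_square algebra_simps)
    then have "w\<^sup>2 - 2 * w - 80 = 6 * w * \<beta>" using b by simp
    then have "delta_nh = (6 * w * \<beta>)\<^sup>2 / (36 * w\<^sup>2)"
      unfolding delta_nh_def k_def[symmetric] w2 w_def[symmetric] by simp
    then show ?thesis using w by (simp add: power_mult_distrib)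
  qed
  ultimately show ?thesis by blast
qed

theorem lemma2p5:
  fixes a b c \<delta> :: real and g :: "real \<Rightarrow> real"
  assumes "a \<noteq> 0"
    and "g = (\<lambda>x. a * x\<^sup>2 + b * x + c)"
    and "\<delta> = b\<^sup>2 - 4 * a * c - 2 * b - 7"
    and "\<delta> \<ge> 0"
  shows "(\<delta> = 0 \<longrightarrow>
            three_cycle g (cycle g a b 0) \<and> points (cycle g a b 0) = cycle_points a b 0 \<and>
            nonhyperbolic g (cycle g a b 0)) \<and>
         (\<delta> > 0 \<longrightarrow>
            three_cycle g (cycle g a b (- sqrt \<delta>)) \<and>
            points (cycle g a b (- sqrt \<delta>)) = cycle_points a b (- sqrt \<delta>) \<and>
            three_cycle g (cycle g a b (sqrt \<delta>)) \<and>
            points (cycle g a b (sqrt \<delta>)) = cycle_points a b (sqrt \<delta>) \<and>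
            hyperbolic g (cycle g a b (- sqrt \<delta>)) \<and>
            (nonhyperbolic g (cycle g a b (sqrt \<delta>)) \<longleftrightarrow> \<delta> = delta_nh)) \<and>
         \<bar>delta_nh - 0.074\<bar> < 0.0005"
proof -
  obtain \<beta> where \<beta>: "\<beta> ^ 3 + \<beta>\<^sup>2 + 7 * \<beta> = 2" and nh: "delta_nh = \<beta>\<^sup>2"
    using delta_nh_eq by blast
  have lo: "0.2715 < \<beta>" and hi: "\<beta> < 0.2725"
    using strict_mono_less[OF cubic_strict_mono, of "0.2715" \<beta>]
      strict_mono_less[OF cubic_strict_mono, of \<beta> "0.2725"] \<beta>
    by (simp_all add: power2_eq_square power3_eq_cube)
  have "0.2715\<^sup>2 < \<beta>\<^sup>2" "\<beta>\<^sup>2 < 0.2725\<^sup>2"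
    using lo hi by (intro power_strict_mono; simp)+
  then have "0.0735 < \<beta>\<^sup>2" "\<beta>\<^sup>2 < 0.0745" by (simp_all add: power2_eq_square)
  then have num: "\<bar>delta_nh - 0.074\<bar> < 0.0005" unfolding nh by (simp add: abs_if)
  have sq: "\<gamma> ^ 3 + \<gamma>\<^sup>2 + 7 * \<gamma> = 2 \<longleftrightarrow> \<gamma> = \<beta>" for \<gamma>
    using strict_mono_eq[OF cubic_strict_mono, of \<gamma> \<beta>] \<beta> by simp
  have \<gamma>: "\<gamma>\<^sup>2 = b\<^sup>2 - 4 * a * c - 2 * b - 7" if "\<gamma>\<^sup>2 = \<delta>" for \<gamma>
    using that assms(3) by simp
  note cycle = cycle_properties[OF assms(1,2) \<gamma>]
    nonhyperbolic_cycle_iff[OF assms(1,2) \<gamma>, unfolded sq]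
  have "nonhyperbolic g (cycle g a b (sqrt \<delta>)) \<longleftrightarrow> \<delta> = delta_nh" if "\<delta> > 0"
  proof -
    have "sqrt \<delta> = \<beta> \<longleftrightarrow> \<delta> = \<beta>\<^sup>2" using that lo by (auto simp: real_sqrt_unique)
    then show ?thesis using cycle(4)[of "sqrt \<delta>"] that nh by simp
  qed
  moreover have "hyperbolic g (cycle g a b (- sqrt \<delta>))" if "\<delta> > 0"
  proof -
    have "- sqrt \<delta> < 0" using that by simp
    moreover have "\<beta> > 0" using lo by simp
    ultimately have "- sqrt \<delta> \<noteq> \<beta>" "- sqrt \<delta> \<noteq> 0" by linarith+
    then show ?thesis using cycle(4)[of "- sqrt \<delta>"] that by simp
  qed
  ultimately show ?thesis
    using num cycle(1,2,4)[of 0] cycle(1,2)[of "sqrt \<delta>"] cycle(1,2)[of "- sqrt \<delta>"] assms(4)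
    by simp
qed

end
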